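(* Let $c=2-\sqrt3$ and let $p$ be the uniform density on $[c,1-c]$. For $b\in\mathbb{R}$ define $f_b(x)=\frac12+b^2-b-|b-x|$ on $[0,1]$. Then for every $\epsilon>0$ there exists $b=b(\epsilon)$ such that for all $1$-Lipschitz functions $f:[0,1]\to\mathbb{R}$ with $\int_0^1f(x)\,dx=0$ we have $\mathrm{Err}(f_b,p)\ge\mathrm{Err}(f,p)-\epsilon$.
   Context: For a $1$-Lipschitz $f$ with $\int_0^1 f=0$ and a density $p$ on $[0,1]$, $\mathrm{Err}(f,p)=\int_0^1p(x)|f(x)|\,dx$ (the expected error when sampling $x\sim p$ and outputting $f(x)$ as an estimate of the average $0$). *)

theory Defs
  imports "HOL-Analysis.Analysis"
begin

definition Err :: "(real \<Rightarrow> real) \<Rightarrow> (real \<Rightarrow> real) \<Rightarrow> real" where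
  "Err f p = integral {0..1} (\<lambda>x. p x * \<bar>f x\<bar>)"

definition uniform_density :: "real \<Rightarrow> real \<Rightarrow> real \<Rightarrow> real" where
  "uniform_density l u x = indicator {l..u} x / (u - l)"

(* The additive constant makes the mean over [0,1] zero exactly when b lies in [0,1];
   for other b the mean is positive. *)
definition tent :: "real \<Rightarrow> real \<Rightarrow> real" where
  "tent b x = 1/2 + b\<^sup>2 - b - \<bar>b - x\<bar>"

end

theory Submission
  imports Defs
begin

text \<open>
  The tent with peak at \<open>1/2\<close> is optimal, with error \<open>c/2\<close>, so the point is to show
  that the integral of \<open>\<bar>f\<bar>\<close> over \<open>[c, 1 - c]\<close> is at most \<open>c (1 - 2 c) / 2\<close>. If \<open>f\<close> has a zero
  in each half of this interval, the bound \<open>\<bar>f x\<bar> \<le> \<bar>x - a\<bar>\<close> around each zero is good enough.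
  Otherwise we may assume by symmetry that \<open>f\<close> is positive on \<open>[c, 1/2]\<close>. Since \<open>f\<close> has mean zero,
  \<open>\<lambda>\<close> times the integral of \<open>f\<close> over \<open>[0, 1]\<close> may be subtracted for free; with \<open>a\<close> the first zero
  of \<open>f\<close> in \<open>[c, 1 - c]\<close> (or \<open>a = 1 - c\<close> if there is none) and \<open>\<lambda> = 2 a - 1\<close>, the Lipschitz
  condition bounds the resulting expression by a function of \<open>a\<close> that exceeds the target by
  \<open>- (u - c) (u - (1 - c) / 2)\<^sup>2 / u \<le> 0\<close>, where \<open>u = 1 - a\<close>. The quadratic factor is a
  perfect square exactly because \<open>c\<^sup>2 - 4 c + 1 = 0\<close>.
\<close>

section \<open>Bounds on integrals of Lipschitz functions\<close>

lemma has_integral_linear_shift: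
  fixes l r s t :: real
  assumes "l \<le> r"
  shows "((\<lambda>x. s * (x - t)) has_integral s * ((r - t)\<^sup>2 - (l - t)\<^sup>2) / 2) {l..r}"
proof -
  have "((\<lambda>x. s * (x - t)) has_integral s * (r - t)\<^sup>2 / 2 - s * (l - t)\<^sup>2 / 2) {l..r}"
    by (rule fundamental_theorem_of_calculus[OF assms])
       (auto intro!: derivative_eq_intros simp flip: has_real_derivative_iff_has_vector_derivative)
  then show ?thesis
    by (simp add: right_diff_distrib diff_divide_distrib)
qed

lemma has_integral_abs_shift:
  fixes l r t :: real
  assumes "t \<in> {l..r}"
  shows "((\<lambda>x. \<bar>x - t\<bar>) has_integral ((t - l)\<^sup>2 + (r - t)\<^sup>2) / 2) {l..r}"
proof -
  have "((\<lambda>x. \<bar>x - t\<bar>) has_integral (t - l)\<^sup>2 / 2) {l..t}"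
    using has_integral_linear_shift[of l t "- 1" t] assms
    by (auto simp: power2_commute elim!: has_integral_eq[rotated])
  moreover have "((\<lambda>x. \<bar>x - t\<bar>) has_integral (r - t)\<^sup>2 / 2) {t..r}"
    using has_integral_linear_shift[of t r 1 t] assms
    by (auto elim!: has_integral_eq[rotated])
  ultimately show ?thesis
    using has_integral_combine[of l t r] assms by (fastforce simp: add_divide_distrib)
qed

text \<open>Integrating \<open>\<bar>g x - g t\<bar> \<le> \<bar>x - t\<bar>\<close> over the
  interval. This replaces an integral by the value at one anchor \<open>t\<close>, which later is
  either a zero or a point whose value cancels.\<close>

lemma ostrowski_inequality:
  fixes g :: "real \<Rightarrow> real"
  assumes lip: "1-lipschitz_on {l..r} g" and t: "t \<in> {l..r}"
  shows "\<bar>integral {l..r} g - (r - l) * g t\<bar> \<le> ((t - l)\<^sup>2 + (r - t)\<^sup>2) / 2"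
proof -
  have g: "g integrable_on {l..r}"
    using lip by (simp add: integrable_continuous_real lipschitz_on_continuous_on)
  have "integral {l..r} g - (r - l) * g t = integral {l..r} (\<lambda>x. g x - g t)"
    using g t by (subst Henstock_Kurzweil_Integration.integral_diff) auto
  moreover have "norm (integral {l..r} (\<lambda>x. g x - g t)) \<le> integral {l..r} (\<lambda>x. \<bar>x - t\<bar>)"
    using g has_integral_abs_shift[OF t] lipschitz_onD[OF lip _ t]
    by (intro integral_norm_bound_integral Henstock_Kurzweil_Integration.integrable_diff)
       (auto simp: dist_real_def)
  ultimately show ?thesis
    using has_integral_abs_shift[OF t] by (simp add: integral_unique)
qed

lemma lipschitz_on_abs:
  fixes f :: "'a::metric_space \<Rightarrow> real"
  assumes "L-lipschitz_on S f"
  shows "L-lipschitz_on S (\<lambda>x. \<bar>f x\<bar>)"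
proof (rule lipschitz_onI)
  fix x y assume "x \<in> S" "y \<in> S"
  then show "dist \<bar>f x\<bar> \<bar>f y\<bar> \<le> L * dist x y"
    using lipschitz_onD[OF assms, of x y] by (simp add: dist_real_def)
qed (rule lipschitz_on_nonneg[OF assms])

lemma integral_reflect_unit:
  fixes f :: "real \<Rightarrow> real"
  shows "integral {l..r} (\<lambda>x. f (1 - x)) = integral {1 - r..1 - l} f"
proof -
  have "integral {l..r} (\<lambda>x. f (1 - x)) = integral {- r..- l} (\<lambda>x. f (1 + x))"
    using Henstock_Kurzweil_Integration.integral_reflect_real[of r l "\<lambda>x. f (1 - x)"] by simp
  also have "\<dots> = integral {1 - r..1 - l} f"
    using integral_shift_real_ivl[of "1 - r" 1 "1 - l" f] by (simp add: add.commute)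
  finally show ?thesis .
qed

section \<open>Arithmetic of the constant \<open>c\<close>\<close>

context
  fixes c :: real
  assumes c_def: "c = 2 - sqrt 3"
begin

lemma c_quadratic: "c\<^sup>2 = 4 * c - 1"
  by (simp add: c_def power2_eq_square algebra_simps)

text \<open>The bound \<open>1 / 4\<close> gives \<open>1 / 2 - c \<le> c\<close>, needed when both
  halves contain a zero, and keeps the central tent nonnegative on
  \<open>{c..1 - c}\<close>.\<close>

lemma c_bounds: "1 / 4 \<le> c" "c < 1 / 2"
proof -
  have "sqrt 3 \<le> 7 / 4" by (rule real_le_lsqrt) (auto simp: power2_eq_square)
  moreover have "3 / 2 < sqrt 3" by (rule real_less_rsqrt) (auto simp: power2_eq_square)
  ultimately show "1 / 4 \<le> c" "c < 1 / 2" by (auto simp: c_def)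
qed

text \<open>The left side is the bound obtained for a first zero at \<open>1 - u\<close>.
  Multiplying the excess by \<open>2 * u\<close> leaves a cubic in \<open>u\<close>, which factors
  once \<open>c_quadratic\<close> removes the remainder.\<close>

lemma dual_value_le:
  assumes "c \<le> u" "u \<le> 1 / 2"
  shows "c\<^sup>2 / (2 * u) - c + u - u\<^sup>2 \<le> c * (1 - 2 * c) / 2"
proof -
  have u: "0 < u" using assms c_bounds by linarith
  have "2 * u * (c\<^sup>2 / (2 * u) - c + u - u\<^sup>2 - c * (1 - 2 * c) / 2)
      = c\<^sup>2 + 2 * u * (- c + u - u\<^sup>2 - c * (1 - 2 * c) / 2)"
    using u by (simp add: field_simps)
  also have "\<dots> = - 2 * (u - c) * (u - (1 - c) / 2)\<^sup>2 + (u - c) * (c\<^sup>2 - 4 * c + 1) / 2"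
    by (simp add: power2_eq_square field_simps)
  also have "\<dots> \<le> 0"
    using assms by (simp add: c_quadratic mult_nonpos_nonneg)
  finally show ?thesis
    using u by (simp add: mult_le_0_iff)
qed

section \<open>The bound for one function, by the position of its zeros\<close>

context
  fixes f :: "real \<Rightarrow> real"
  assumes lip: "1-lipschitz_on {0..1} f" and mean: "integral {0..1} f = 0"
begin

lemma integrable_sub: "{l..r} \<subseteq> {0..1} \<Longrightarrow> f integrable_on {l..r}"
  "{l..r} \<subseteq> {0..1} \<Longrightarrow> (\<lambda>x. \<bar>f x\<bar>) integrable_on {l..r}"
  using lipschitz_on_continuous_on[OF lip]
  by (auto intro!: integrable_continuous_real continuous_intros intro: continuous_on_subset)

text \<open>The version for \<open>f\<close> is combined with the mean-zero condition; the version
  for \<open>\<bar>f\<bar>\<close> handles pieces on which the sign is unknown.\<close>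

lemma ostrowski_sub:
  assumes "0 \<le> l" "r \<le> 1" "t \<in> {l..r}"
  shows "\<bar>integral {l..r} f - (r - l) * f t\<bar> \<le> ((t - l)\<^sup>2 + (r - t)\<^sup>2) / 2"
    and "\<bar>integral {l..r} (\<lambda>x. \<bar>f x\<bar>) - (r - l) * \<bar>f t\<bar>\<bar> \<le> ((t - l)\<^sup>2 + (r - t)\<^sup>2) / 2"
proof -
  have lr: "1-lipschitz_on {l..r} f" using assms by (intro lipschitz_on_subset[OF lip]) auto
  show "\<bar>integral {l..r} f - (r - l) * f t\<bar> \<le> ((t - l)\<^sup>2 + (r - t)\<^sup>2) / 2"
    and "\<bar>integral {l..r} (\<lambda>x. \<bar>f x\<bar>) - (r - l) * \<bar>f t\<bar>\<bar> \<le> ((t - l)\<^sup>2 + (r - t)\<^sup>2) / 2"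
    using ostrowski_inequality[OF lr assms(3)]
      ostrowski_inequality[OF lipschitz_on_abs[OF lr] assms(3)] by this
qed

lemma split_integral:
  assumes "0 \<le> l" "l \<le> m" "m \<le> r" "r \<le> 1"
  shows "integral {l..r} f = integral {l..m} f + integral {m..r} f"
    and "integral {l..r} (\<lambda>x. \<bar>f x\<bar>) = integral {l..m} (\<lambda>x. \<bar>f x\<bar>) + integral {m..r} (\<lambda>x. \<bar>f x\<bar>)"
  using assms Henstock_Kurzweil_Integration.integral_combine[of l m r] integrable_sub[of l r]
  by fastforce+

lemma abs_integral_le_two_zeros:
  assumes "a \<in> {c..1 / 2}" "f a = 0" "d \<in> {1 / 2..1 - c}" "f d = 0"
  shows "integral {c..1 - c} (\<lambda>x. \<bar>f x\<bar>) \<le> c * (1 - 2 * c) / 2"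
proof -
  have sq: "(x\<^sup>2 + y\<^sup>2) / 2 \<le> (1 / 2 - c)\<^sup>2 / 2" if "0 \<le> x" "0 \<le> y" "x + y = 1 / 2 - c" for x y
    unfolding that(3)[symmetric] using mult_nonneg_nonneg[OF that(1,2)] by (simp add: power2_sum)
  have "integral {c..1 / 2} (\<lambda>x. \<bar>f x\<bar>) \<le> (1 / 2 - c)\<^sup>2 / 2"
    using ostrowski_sub(2)[of c "1 / 2" a] sq[of "a - c" "1 / 2 - a"] assms c_bounds by auto
  moreover have "integral {1 / 2..1 - c} (\<lambda>x. \<bar>f x\<bar>) \<le> (1 / 2 - c)\<^sup>2 / 2"
    using ostrowski_sub(2)[of "1 / 2" "1 - c" d] sq[of "d - 1 / 2" "1 - c - d"] assms c_bounds
    by auto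
  moreover have "(1 / 2 - c)\<^sup>2 \<le> c * (1 / 2 - c)"
    unfolding power2_eq_square using c_bounds by (intro mult_right_mono) auto
  ultimately show ?thesis
    using split_integral(2)[of c "1 / 2" "1 - c"] c_bounds by (simp add: algebra_simps)
qed

lemma abs_integral_le_no_zero:
  assumes "\<And>x. x \<in> {c..1 - c} \<Longrightarrow> 0 \<le> f x"
  shows "integral {c..1 - c} (\<lambda>x. \<bar>f x\<bar>) \<le> c * (1 - 2 * c) / 2"
proof -
  define I1 I2 I3 I4 where "I1 = integral {0..c} f" and "I2 = integral {c..1 / 2} f"
    and "I3 = integral {1 / 2..1 - c} f" and "I4 = integral {1 - c..1} f"
  have I: "integral {c..1 - c} (\<lambda>x. \<bar>f x\<bar>) = I2 + I3"
  proof -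
    have "integral {c..1 - c} (\<lambda>x. \<bar>f x\<bar>) = integral {c..1 - c} f"
      using assms by (intro integral_cong) auto
    then show ?thesis
      using split_integral(1)[of c "1 / 2" "1 - c"] c_bounds by (simp add: I2_def I3_def)
  qed
  have zero: "I1 + I2 + I3 + I4 = 0"
    using split_integral(1)[of 0 c 1] split_integral(1)[of c "1 / 2" 1]
      split_integral(1)[of "1 / 2" "1 - c" 1] c_bounds mean
    by (simp add: I1_def I2_def I3_def I4_def)
  have "\<bar>I1 - c * f c\<bar> \<le> c\<^sup>2 / 2" "\<bar>I2 - (1 / 2 - c) * f c\<bar> \<le> (1 / 2 - c)\<^sup>2 / 2"
    "\<bar>I3 - (1 / 2 - c) * f (1 - c)\<bar> \<le> (1 / 2 - c)\<^sup>2 / 2" "\<bar>I4 - c * f (1 - c)\<bar> \<le> c\<^sup>2 / 2"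
    using ostrowski_sub(1)[of 0 c c] ostrowski_sub(1)[of c "1 / 2" c]
      ostrowski_sub(1)[of "1 / 2" "1 - c" "1 - c"] ostrowski_sub(1)[of "1 - c" 1 "1 - c"] c_bounds
    by (auto simp: I1_def I2_def I3_def I4_def)
  \<comment> \<open>As the mean is zero,
    \<open>I2 + I3 = 2 * c * (I2 + I3) - (1 - 2 * c) * (I1 + I4)\<close>. With these weights the
    unknown values \<open>f c\<close> and \<open>f (1 - c)\<close> both cancel.\<close>
  then have "(1 - 2 * c) * (c * f c - c\<^sup>2 / 2 + (c * f (1 - c) - c\<^sup>2 / 2)) \<le> (1 - 2 * c) * (I1 + I4)"
    "2 * c * (I2 + I3) \<le> 2 * c * ((1 / 2 - c) * f c + (1 / 2 - c)\<^sup>2 / 2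
      + ((1 / 2 - c) * f (1 - c) + (1 / 2 - c)\<^sup>2 / 2))"
    using c_bounds by (intro mult_left_mono; linarith)+
  moreover have "I1 + I4 = - (I2 + I3)" using zero by linarith
  ultimately have "I2 + I3 \<le> 2 * c * (1 / 2 - c)\<^sup>2 + (1 - 2 * c) * c\<^sup>2"
    by (simp add: algebra_simps)
  also have "\<dots> = c * (1 - 2 * c) / 2"
    by (simp add: power2_eq_square field_simps)
  finally show ?thesis by (simp add: I)
qed

lemma abs_integral_le_first_zero:
  assumes a: "a \<in> {1 / 2..1 - c}" "f a = 0" and pos: "\<And>x. x \<in> {c..a} \<Longrightarrow> 0 \<le> f x"
  shows "integral {c..1 - c} (\<lambda>x. \<bar>f x\<bar>) \<le> c * (1 - 2 * c) / 2"
proof -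
  define u where "u = 1 - a"
  have u: "c \<le> u" "u \<le> 1 / 2" "0 < u" using a c_bounds by (auto simp: u_def)
  \<comment> \<open>The peak of the extremal function, chosen so that \<open>f c\<close> cancels in the final estimate.\<close>
  define b where "b = c / (2 * u)"
  have ub: "u * b = c / 2" using u by (simp add: b_def)
  have "c \<le> b" using u c_bounds by (simp add: b_def field_simps)
  moreover have "b \<le> 1 / 2" using u by (simp add: b_def field_simps)
  ultimately have b: "c \<le> b" "b \<le> a" using a by auto
  define I1 I2 I3 I4 J where "I1 = integral {0..c} f" and "I2 = integral {c..b} f"
    and "I3 = integral {b..a} f" and "I4 = integral {a..1} f"
    and "J = integral {a..1 - c} (\<lambda>x. \<bar>f x\<bar>)"
  have I: "integral {c..1 - c} (\<lambda>x. \<bar>f x\<bar>) = I2 + I3 + J"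
  proof -
    have "integral {c..a} (\<lambda>x. \<bar>f x\<bar>) = integral {c..a} f"
      using pos by (intro integral_cong) auto
    then show ?thesis
      using split_integral(1)[of c b a] split_integral(2)[of c a "1 - c"] a b c_bounds
      by (simp add: I2_def I3_def J_def)
  qed
  have zero: "I1 + I2 + I3 + I4 = 0"
    using split_integral(1)[of 0 c 1] split_integral(1)[of c b 1] split_integral(1)[of b a 1]
      a b c_bounds mean
    by (simp add: I1_def I2_def I3_def I4_def)
  \<comment> \<open>The anchor is \<open>c\<close> for the first two pieces and the zero
    \<open>a\<close> for the others. Beyond \<open>a\<close> the sign of \<open>f\<close> is not
    known, so \<open>J\<close> is bounded through \<open>\<bar>f\<bar>\<close>.\<close>
  have "\<bar>I1 - c * f c\<bar> \<le> c\<^sup>2 / 2" "\<bar>I2 - (b - c) * f c\<bar> \<le> (b - c)\<^sup>2 / 2"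
    "\<bar>I3\<bar> \<le> (a - b)\<^sup>2 / 2" "\<bar>I4\<bar> \<le> u\<^sup>2 / 2" and J: "\<bar>J\<bar> \<le> (u - c)\<^sup>2 / 2"
    using ostrowski_sub(1)[of 0 c c] ostrowski_sub(1)[of c b c]
      ostrowski_sub(1)[of b a a] ostrowski_sub(1)[of a 1 a] ostrowski_sub(2)[of a "1 - c" a]
      a b c_bounds
    by (auto simp: I1_def I2_def I3_def I4_def J_def u_def algebra_simps)
  \<comment> \<open>The mean-zero condition gives
    \<open>I2 + I3 = 2 * u * (I2 + I3) - (1 - 2 * u) * (I1 + I4)\<close>, and both weights are
    nonnegative.\<close>
  then have "(1 - 2 * u) * (c * f c - c\<^sup>2 / 2 - u\<^sup>2 / 2) \<le> (1 - 2 * u) * (I1 + I4)"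
    "2 * u * (I2 + I3) \<le> 2 * u * ((b - c) * f c + (b - c)\<^sup>2 / 2 + (a - b)\<^sup>2 / 2)"
    using u by (intro mult_left_mono; linarith)+
  moreover have "I1 + I4 = - (I2 + I3)" using zero by linarith
  ultimately have "I2 + I3 \<le> 2 * u * ((b - c) * f c + (b - c)\<^sup>2 / 2 + (a - b)\<^sup>2 / 2)
      - (1 - 2 * u) * (c * f c - c\<^sup>2 / 2 - u\<^sup>2 / 2)"
    by (simp add: algebra_simps)
  also have "\<dots> = (2 * (u * b) - c) * f c + u * ((b - c)\<^sup>2 + (a - b)\<^sup>2)
      + (1 - 2 * u) * (c\<^sup>2 + u\<^sup>2) / 2"
    by (simp add: field_simps)
  \<comment> \<open>Grouping by the product \<open>u * b\<close> lets \<open>ub\<close> replace it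
    by \<open>c / 2\<close>, which also makes the coefficient of \<open>f c\<close> vanish.\<close>
  also have "u * ((b - c)\<^sup>2 + (a - b)\<^sup>2)
      = 2 * b * (u * b) - 2 * (u * b) * (c + 1 - u) + u * (c\<^sup>2 + (1 - u)\<^sup>2)"
    by (simp add: u_def power2_eq_square algebra_simps)
  finally have "I2 + I3 + J \<le> b * c - c * (c + 1 - u) + u * (c\<^sup>2 + (1 - u)\<^sup>2)
      + (1 - 2 * u) * (c\<^sup>2 + u\<^sup>2) / 2 + (u - c)\<^sup>2 / 2"
    using J by (simp add: ub)
  also have "\<dots> = b * c - c + u - u\<^sup>2"
    by (simp add: power2_eq_square field_simps)
  also have "\<dots> = c\<^sup>2 / (2 * u) - c + u - u\<^sup>2"
    by (simp add: b_def power2_eq_square)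
  also have "\<dots> \<le> c * (1 - 2 * c) / 2"
    using u by (intro dual_value_le)
  finally show ?thesis by (simp add: I)
qed

lemma abs_integral_le_pos_left:
  assumes nz: "\<And>x. x \<in> {c..1 / 2} \<Longrightarrow> f x \<noteq> 0" and "0 < f c"
  shows "integral {c..1 - c} (\<lambda>x. \<bar>f x\<bar>) \<le> c * (1 - 2 * c) / 2"
proof -
  have cont: "continuous_on {l..r} f" if "0 \<le> l" "r \<le> 1" for l r
    using that by (auto intro: continuous_on_subset[OF lipschitz_on_continuous_on[OF lip]])
  \<comment> \<open>A negative value would force an earlier zero by the intermediate value theorem.
    The half-open interval allows \<open>x\<close> to be the first zero itself.\<close>
  have nonneg: "0 \<le> f x" if x: "x \<in> {c..1 - c}" and "\<And>y. y \<in> {c..<x} \<Longrightarrow> f y \<noteq> 0" for x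
  proof (rule ccontr)
    assume neg: "\<not> 0 \<le> f x"
    then obtain y where "c \<le> y" "y \<le> x" "f y = 0"
      using IVT2'[of f x 0 c] cont[of c x] x \<open>0 < f c\<close> c_bounds by fastforce
    then show False using that(2)[of y] neg by (cases "y = x") auto
  qed
  \<comment> \<open>Compactness of the zero set provides a first zero; by \<open>nz\<close> it lies
    in the right half.\<close>
  define Z where "Z = {x \<in> {c..1 - c}. f x = 0}"
  show ?thesis
  proof (cases "Z = {}")
    case True
    then show ?thesis
      by (intro abs_integral_le_no_zero nonneg) (auto simp: Z_def)
  next
    case False
    have "closed Z"
      unfolding Z_def using cont[of c "1 - c"] c_bounds
      by (intro continuous_closed_preimage_constant) auto
    moreover have "bounded Z"
      by (rule bounded_subset[OF bounded_closed_interval]) (auto simp: Z_def)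
    ultimately have "compact Z"
      by (simp add: compact_eq_bounded_closed)
    then obtain a where a: "a \<in> Z" "\<And>x. x \<in> Z \<Longrightarrow> a \<le> x"
      using compact_attains_inf[of Z] False by auto
    show ?thesis
    proof (rule abs_integral_le_first_zero)
      show "a \<in> {1 / 2..1 - c}" "f a = 0" using a(1) nz[of a] by (cases "a \<le> 1 / 2"; simp add: Z_def)+
      show "0 \<le> f x" if "x \<in> {c..a}" for x
      proof (rule nonneg)
        show "x \<in> {c..1 - c}" using that a(1) by (simp add: Z_def)
        then show "f y \<noteq> 0" if "y \<in> {c..<x}" for y
          using that a(2)[of y] \<open>x \<in> {c..a}\<close> by (auto simp: Z_def)
      qed
    qed
  qed
qed

end

section \<open>Reduction by the symmetries of sign and reflection\<close>

lemma abs_integral_le_no_zero_left: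
  fixes f :: "real \<Rightarrow> real"
  assumes lip: "1-lipschitz_on {0..1} f" and mean: "integral {0..1} f = 0"
    and nz: "\<And>x. x \<in> {c..1 / 2} \<Longrightarrow> f x \<noteq> 0"
  shows "integral {c..1 - c} (\<lambda>x. \<bar>f x\<bar>) \<le> c * (1 - 2 * c) / 2"
proof (cases "0 < f c")
  case True
  then show ?thesis using abs_integral_le_pos_left assms by blast
next
  case False
  moreover have "f c \<noteq> 0" using nz c_bounds by auto
  moreover have "1-lipschitz_on {0..1} (\<lambda>x. - f x)" using lip by simp
  ultimately show ?thesis
    using mean nz abs_integral_le_pos_left[of "\<lambda>x. - f x"] by auto
qed

lemma abs_integral_le:
  fixes f :: "real \<Rightarrow> real"
  assumes lip: "1-lipschitz_on {0..1} f" and mean: "integral {0..1} f = 0"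
  shows "integral {c..1 - c} (\<lambda>x. \<bar>f x\<bar>) \<le> c * (1 - 2 * c) / 2"
proof -
  consider "\<forall>x\<in>{c..1 / 2}. f x \<noteq> 0" | "\<forall>x\<in>{1 / 2..1 - c}. f x \<noteq> 0"
    | a d where "a \<in> {c..1 / 2}" "f a = 0" "d \<in> {1 / 2..1 - c}" "f d = 0"
    by blast
  then show ?thesis
  proof cases
    case 1
    then show ?thesis using abs_integral_le_no_zero_left[OF lip mean] by blast
  next
    case 2
    \<comment> \<open>Reflection exchanges the halves of \<open>{c..1 - c}\<close> and preserves the
      mean.\<close>
    have "1-lipschitz_on {0..1} (\<lambda>x. f (1 - x))"
    proof (rule lipschitz_onI)
      fix x y :: real assume "x \<in> {0..1}" "y \<in> {0..1}"
      then show "dist (f (1 - x)) (f (1 - y)) \<le> 1 * dist x y"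
        using lipschitz_onD[OF lip, of "1 - x" "1 - y"] by (simp add: dist_real_def)
    qed simp
    then have "integral {c..1 - c} (\<lambda>x. \<bar>f (1 - x)\<bar>) \<le> c * (1 - 2 * c) / 2"
      using 2 mean by (intro abs_integral_le_no_zero_left) (auto simp: integral_reflect_unit)
    then show ?thesis
      using integral_reflect_unit[of c "1 - c" "\<lambda>x. \<bar>f x\<bar>"] by simp
  next
    case 3
    then show ?thesis using abs_integral_le_two_zeros[OF lip mean] by blast
  qed
qed

section \<open>Errors under the uniform density and the optimal tent\<close>

lemma Err_uniform:
  "Err f (uniform_density c (1 - c)) = integral {c..1 - c} (\<lambda>x. \<bar>f x\<bar>) / (1 - 2 * c)"
proof -
  have "Err f (uniform_density c (1 - c))
      = integral {0..1} (\<lambda>x. if x \<in> {c..1 - c} then \<bar>f x\<bar> / (1 - 2 * c) else 0)"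
    unfolding Err_def uniform_density_def by (intro integral_cong) (auto simp: algebra_simps)
  also have "\<dots> = integral {c..1 - c} (\<lambda>x. \<bar>f x\<bar> / (1 - 2 * c))"
    using c_bounds
    by (simp only: Henstock_Kurzweil_Integration.integral_restrict_Int)
       (intro arg_cong2[where f = integral], auto)
  finally show ?thesis by simp
qed

lemma Err_tent_half: "Err (tent (1 / 2)) (uniform_density c (1 - c)) = c / 2"
proof -
  have "((\<lambda>x. 1 / 4 - \<bar>x - 1 / 2\<bar>) has_integral
      (1 - c - c) * (1 / 4) - ((1 / 2 - c)\<^sup>2 + (1 - c - 1 / 2)\<^sup>2) / 2) {c..1 - c}"
    using c_bounds has_integral_const_real[of "1 / 4 :: real" c "1 - c"]
    by (intro has_integral_diff has_integral_abs_shift) auto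
  moreover have "\<bar>tent (1 / 2) x\<bar> = 1 / 4 - \<bar>x - 1 / 2\<bar>" if "x \<in> {c..1 - c}" for x
  proof -
    have "tent (1 / 2) x = 1 / 4 - \<bar>x - 1 / 2\<bar>"
      by (simp add: tent_def power2_eq_square abs_minus_commute)
    moreover have "\<bar>x - 1 / 2\<bar> \<le> 1 / 4"
      unfolding abs_le_iff using that c_bounds by simp
    ultimately show ?thesis by simp
  qed
  ultimately have "integral {c..1 - c} (\<lambda>x. \<bar>tent (1 / 2) x\<bar>)
      = (1 - c - c) * (1 / 4) - ((1 / 2 - c)\<^sup>2 + (1 - c - 1 / 2)\<^sup>2) / 2"
    by (metis (no_types, lifting) has_integral_cong integral_unique)
  also have "\<dots> = c / 2 * (1 - 2 * c)"
    by (simp add: power2_eq_square field_simps)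
  finally show ?thesis using c_bounds by (simp add: Err_uniform)
qed

end

theorem theorem5:
  fixes c :: real and p :: "real \<Rightarrow> real"
  assumes "c = 2 - sqrt 3"
    and "p = uniform_density c (1 - c)"
  shows "\<forall>\<epsilon>>0. \<exists>b\<in>{0..1}. \<forall>f :: real \<Rightarrow> real.
           1-lipschitz_on {0..1} f \<and> integral {0..1} f = 0 \<longrightarrow>
           Err (tent b) p \<ge> Err f p - \<epsilon>"
proof -
  have "Err f p \<le> Err (tent (1 / 2)) p"
    if "1-lipschitz_on {0..1} f" "integral {0..1} f = 0" for f
    using abs_integral_le[OF assms(1) that] c_bounds[OF assms(1)]
    unfolding assms(2) Err_tent_half[OF assms(1)] Err_uniform[OF assms(1), of f]
    by (simp add: pos_divide_le_eq)
  \<comment> \<open>The peak \<open>1 / 2\<close> serves every \<open>\<epsilon>\<close>, since this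
    tent already attains the maximal error.\<close>
  then show ?thesis
    by (intro allI impI bexI[where x = "1 / 2"]) (auto intro: add_increasing2 simp: diff_le_eq)
qed

end
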